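(* Let $K_0\subseteq\overline{\mathbb{Q}}$ be a totally real field and let $K_1$ be the maximal totally real subfield of $K_0^{(2)}$. If $K\supseteq K_1$ is a totally real field, then for every totally imaginary quadratic extension $L$ of $K$ there is a subset $X\subseteq\mathcal{O}_L$, existentially definable in the ring $\mathcal{O}_L$, satisfying $$\mathcal{O}_{K_0}\subseteq X\subseteq\mathcal{O}_K.$$
   Context: $\overline{\mathbb{Q}}\subseteq\mathbb{C}$; $\mathcal{O}_F$ is the ring of algebraic integers of a field $F$. For a field $F$, $F^{(2)}$ denotes the compositum (in $\overline{\mathbb{Q}}$) of all extensions of $F$ of degree at most $2$. A field is totally real if all its elements have only real conjugates; totally imaginary means having no embedding into $\mathbb{R}$. Existential definability is in the language of rings. *)

theory Defs
  imports Complex_Main "HOL-Algebra.Generated_Fields" "HOL-Algebra.Embedded_Algebras"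
    "HOL-Algebra.Algebraic_Closure_Type"
begin

abbreviation complex_ring :: "complex ring" where
  "complex_ring \<equiv> ring_of_type_algebra"

abbreviation real_ring :: "real ring" where
  "real_ring \<equiv> ring_of_type_algebra"

definition algebraic_numbers :: "complex set" where
  "algebraic_numbers = {z. algebraic z}"

text \<open>Fields are the subfields of the fixed algebraic closure of the rationals inside the
  complex numbers; they may have infinite degree over the rationals.\<close>

definition algebraic_field :: "complex set \<Rightarrow> bool" where
  "algebraic_field F \<longleftrightarrow> subfield F complex_ring \<and> F \<subseteq> algebraic_numbers"

definition ring_of_integers :: "complex set \<Rightarrow> complex set" where
  "ring_of_integers F = {x \<in> F. algebraic_int x}"

definition extension_of_degree :: "nat \<Rightarrow> complex set \<Rightarrow> complex set \<Rightarrow> bool" where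
  "extension_of_degree n F E \<longleftrightarrow>
     algebraic_field F \<and> algebraic_field E \<and> F \<subseteq> E \<and> ring.dimension complex_ring n F E"

definition quadratic_compositum :: "complex set \<Rightarrow> complex set" where
  "quadratic_compositum F =
     generate_field complex_ring (\<Union>{E. \<exists>n\<le>2. extension_of_degree n F E})"

text \<open>Two numbers are conjugate if they have the same minimal polynomial over the rationals,
  i.e. are roots of a common irreducible rational polynomial.\<close>

definition conjugate :: "complex \<Rightarrow> complex \<Rightarrow> bool" where
  "conjugate x y \<longleftrightarrow> (\<exists>p :: rat poly. Factorial_Ring.irreducible p \<and>
     poly (map_poly of_rat p) x = 0 \<and> poly (map_poly of_rat p) y = 0)"

definition totally_real :: "complex set \<Rightarrow> bool" where
  "totally_real F \<longleftrightarrow> algebraic_field F \<and> (\<forall>x\<in>F. \<forall>y. conjugate x y \<longrightarrow> y \<in> \<real>)"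

definition totally_imaginary :: "complex set \<Rightarrow> bool" where
  "totally_imaginary F \<longleftrightarrow> algebraic_field F \<and>
     \<not> (\<exists>h \<in> ring_hom (complex_ring\<lparr>carrier := F\<rparr>) real_ring. inj_on h F)"

text \<open>Maximality is with respect to inclusion. As a compositum of totally real fields is totally
  real, there is exactly one maximal totally real subfield of a given field.\<close>

definition maximal_totally_real_subfield :: "complex set \<Rightarrow> complex set \<Rightarrow> bool" where
  "maximal_totally_real_subfield M F \<longleftrightarrow> totally_real M \<and> M \<subseteq> F \<and>
     (\<forall>E. totally_real E \<and> M \<subseteq> E \<and> E \<subseteq> F \<longrightarrow> E = M)"

datatype ring_term =
    TVar nat
  | TZero
  | TOne
  | TNeg ring_term
  | TAdd ring_term ring_term
  | TMult ring_term ring_term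

datatype qf_formula =
    QEq ring_term ring_term
  | QNot qf_formula
  | QAnd qf_formula qf_formula
  | QOr qf_formula qf_formula

primrec term_value :: "('a, 'm) ring_scheme \<Rightarrow> (nat \<Rightarrow> 'a) \<Rightarrow> ring_term \<Rightarrow> 'a" where
  "term_value R e (TVar i) = e i"
| "term_value R e TZero = \<zero>\<^bsub>R\<^esub>"
| "term_value R e TOne = \<one>\<^bsub>R\<^esub>"
| "term_value R e (TNeg t) = \<ominus>\<^bsub>R\<^esub> term_value R e t"
| "term_value R e (TAdd s t) = term_value R e s \<oplus>\<^bsub>R\<^esub> term_value R e t"
| "term_value R e (TMult s t) = term_value R e s \<otimes>\<^bsub>R\<^esub> term_value R e t"

primrec qf_holds :: "('a, 'm) ring_scheme \<Rightarrow> (nat \<Rightarrow> 'a) \<Rightarrow> qf_formula \<Rightarrow> bool" where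
  "qf_holds R e (QEq s t) \<longleftrightarrow> term_value R e s = term_value R e t"
| "qf_holds R e (QNot p) \<longleftrightarrow> \<not> qf_holds R e p"
| "qf_holds R e (QAnd p q) \<longleftrightarrow> qf_holds R e p \<and> qf_holds R e q"
| "qf_holds R e (QOr p q) \<longleftrightarrow> qf_holds R e p \<or> qf_holds R e q"

text \<open>Definability is without parameters, by a formula consisting of a block of existential
  quantifiers followed by a quantifier-free formula. Variable 0 is the free variable and all
  others are existentially quantified; a formula mentions only finitely many variables, so the
  quantification over whole assignments amounts to a finite block of quantifiers over R.\<close>

definition existentially_definable :: "('a, 'm) ring_scheme \<Rightarrow> 'a set \<Rightarrow> bool" where
  "existentially_definable R S \<longleftrightarrow> (\<exists>p. S = {x \<in> carrier R.
     \<exists>e. (\<forall>i. e i \<in> carrier R) \<and> e 0 = x \<and> qf_holds R e p})"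

end

theory Submission
  imports Defs "Jordan_Normal_Form.Char_Poly"
begin

text \<open>If \<open>u = 1 + 3 * w\<close> is a unit of the integers of \<open>L\<close>, then \<open>u / cnj u\<close> has absolute value 1
  under every embedding and is congruent to 1 modulo 3. Hence it equals 1, and \<open>u\<close> lies in \<open>K\<close>.
  Conversely, for an integer \<open>x\<close> of \<open>K\<^sub>0\<close> the number \<open>9 * x\<^sup>2 + 2\<close> is totally positive, so its square
  root \<open>s\<close> lies in \<open>K\<^sub>1\<close>, and \<open>u = 1 + 9 * x\<^sup>2 + 3 * x * s\<close> is such a unit with
  \<open>u + inverse u = 2 + 18 * x\<^sup>2\<close>. So the traces of these units are existentially definable elements
  of \<open>K\<close> that include a quadratic polynomial in \<open>x\<close>, and \<open>x\<close> itself is recovered linearly from the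
  difference of the values at \<open>x + 1\<close> and \<open>x\<close>.\<close>

section \<open>Integral closure\<close>

text \<open>Working with a subset of a field lets one proof of integral closure serve the integers
  (algebraic integers) and the rationals (algebraic numbers). The closure rules are later inherited
  by every field of algebraic numbers.\<close>

locale coefficient_ring =
  fixes R :: "'a :: field_char_0 set"
  assumes one_mem: "1 \<in> R"
    and diff_mem: "\<lbrakk>a \<in> R; b \<in> R\<rbrakk> \<Longrightarrow> a - b \<in> R"
    and mult_mem: "\<lbrakk>a \<in> R; b \<in> R\<rbrakk> \<Longrightarrow> a * b \<in> R"
begin

lemma zero_mem: "0 \<in> R"
  using diff_mem[OF one_mem one_mem] by simp

lemma minus_mem: "a \<in> R \<Longrightarrow> - a \<in> R"
  using diff_mem[OF zero_mem] by force

lemma add_mem: "\<lbrakk>a \<in> R; b \<in> R\<rbrakk> \<Longrightarrow> a + b \<in> R"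
  using diff_mem[OF _ minus_mem] by force

lemma sum_mem: "(\<And>i. i \<in> A \<Longrightarrow> f i \<in> R) \<Longrightarrow> (\<Sum>i\<in>A. f i) \<in> R"
  by (induction A rule: infinite_finite_induct) (auto intro: zero_mem add_mem)

definition polys :: "'a poly set" where
  "polys = {p. \<forall>i. coeff p i \<in> R}"

lemma polys_diff: "p \<in> polys \<Longrightarrow> q \<in> polys \<Longrightarrow> p - q \<in> polys"
  by (simp add: polys_def diff_mem)

lemma polys_0: "0 \<in> polys" by (simp add: polys_def zero_mem)

lemma polys_add: "p \<in> polys \<Longrightarrow> q \<in> polys \<Longrightarrow> p + q \<in> polys"
  by (simp add: polys_def add_mem)

lemma polys_mult: "p \<in> polys \<Longrightarrow> q \<in> polys \<Longrightarrow> p * q \<in> polys"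
  by (auto simp: polys_def coeff_mult intro!: sum_mem mult_mem)

lemma polys_pCons: "a \<in> R \<Longrightarrow> p \<in> polys \<Longrightarrow> pCons a p \<in> polys"
  by (auto simp: polys_def coeff_pCons split: nat.split)

lemma polys_1: "1 \<in> polys"
  unfolding one_pCons by (intro polys_pCons one_mem polys_0)

lemma polys_sum: "(\<And>i. i \<in> A \<Longrightarrow> f i \<in> polys) \<Longrightarrow> (\<Sum>i\<in>A. f i) \<in> polys"
  by (induction A rule: infinite_finite_induct) (auto intro: polys_0 polys_add)

lemma polys_prod: "(\<And>i. i \<in> A \<Longrightarrow> f i \<in> polys) \<Longrightarrow> (\<Prod>i\<in>A. f i) \<in> polys"
  by (induction A rule: infinite_finite_induct) (auto intro: polys_1 polys_mult)

text \<open>By the Leibniz expansion the determinant is a signed sum of products of entries of the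
  characteristic matrix, and these entries are polynomials over \<open>R\<close>.\<close>

lemma char_poly_mem_polys:
  assumes A: "A \<in> carrier_mat n n" and R: "\<And>i j. i < n \<Longrightarrow> j < n \<Longrightarrow> A $$ (i, j) \<in> R"
  shows "char_poly A \<in> polys"
proof -
  have entry: "char_poly_matrix A $$ (i, j) \<in> polys" if "i < n" "j < n" for i j
    using A that R[OF that] by (auto simp: char_poly_matrix_def zero_mem one_mem minus_mem
        intro!: polys_pCons polys_0 polys_1 polys_add)
  have sign: "(signof f :: 'a poly) \<in> polys" for f :: "nat \<Rightarrow> nat"
    using polys_diff[OF polys_0 polys_1] by (auto simp: sign_def polys_1)
  show ?thesis
    unfolding char_poly_def det_def'[OF char_poly_matrix_closed[OF A]]
    by (intro polys_sum polys_mult polys_prod sign entry) (auto simp: permutes_in_image)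
qed

definition integral :: "'a \<Rightarrow> bool" where
  "integral x \<longleftrightarrow> (\<exists>p \<in> polys. lead_coeff p = 1 \<and> poly p x = 0)"

definition lin_comb :: "'a set \<Rightarrow> 'a set" where
  "lin_comb S = {\<Sum>b\<in>S. c b * b | c. \<forall>b. c b \<in> R}"

lemma lin_comb_add:
  assumes "u \<in> lin_comb S" "v \<in> lin_comb S"
  shows "u + v \<in> lin_comb S"
proof -
  from assms obtain c d where c: "\<forall>b. c b \<in> R" "u = (\<Sum>b\<in>S. c b * b)"
    and d: "\<forall>b. d b \<in> R" "v = (\<Sum>b\<in>S. d b * b)" unfolding lin_comb_def by auto
  then have "u + v = (\<Sum>b\<in>S. (c b + d b) * b)" "\<forall>b. c b + d b \<in> R"
    by (auto simp: sum.distrib distrib_right intro: add_mem)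
  then show ?thesis unfolding lin_comb_def mem_Collect_eq by (intro exI[of _ "\<lambda>b. c b + d b"]) auto
qed

lemma lin_comb_scale:
  assumes "a \<in> R" "v \<in> lin_comb S"
  shows "a * v \<in> lin_comb S"
proof -
  from assms obtain d where d: "\<forall>b. d b \<in> R" "v = (\<Sum>b\<in>S. d b * b)"
    unfolding lin_comb_def by auto
  then have "a * v = (\<Sum>b\<in>S. (a * d b) * b)" "\<forall>b. a * d b \<in> R"
    by (auto simp: sum_distrib_left mult.assoc assms intro: mult_mem)
  then show ?thesis unfolding lin_comb_def mem_Collect_eq by (intro exI[of _ "\<lambda>b. a * d b"]) auto
qed

lemma lin_comb_0: "0 \<in> lin_comb S"
  unfolding lin_comb_def mem_Collect_eq by (intro exI[of _ "\<lambda>_. 0"]) (auto simp: zero_mem)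

lemma lin_comb_sum: "(\<And>i. i \<in> A \<Longrightarrow> f i \<in> lin_comb S) \<Longrightarrow> (\<Sum>i\<in>A. f i) \<in> lin_comb S"
  by (induction A rule: infinite_finite_induct) (auto intro: lin_comb_0 lin_comb_add)

lemma lin_comb_base:
  assumes "finite S" "b \<in> S"
  shows "b \<in> lin_comb S"
proof -
  have "b = (\<Sum>a\<in>S. (if a = b then 1 else 0) * a)"
    using assms by (simp add: if_distrib[of "\<lambda>x. x * _"] sum.delta cong: if_cong)
  then show ?thesis unfolding lin_comb_def mem_Collect_eq
    by (intro exI[of _ "\<lambda>a. if a = b then 1 else 0"]) (auto simp: zero_mem one_mem)
qed

lemma lin_comb_mult:
  assumes "\<And>b. b \<in> S \<Longrightarrow> x * b \<in> lin_comb S" "v \<in> lin_comb S"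
  shows "x * v \<in> lin_comb S"
proof -
  from assms(2) obtain d where d: "\<forall>b. d b \<in> R" "v = (\<Sum>b\<in>S. d b * b)"
    unfolding lin_comb_def by auto
  have eq: "x * v = (\<Sum>b\<in>S. d b * (x * b))"
    by (simp add: d(2) sum_distrib_left ac_simps)
  show ?thesis unfolding eq using d(1) assms(1) by (blast intro: lin_comb_sum lin_comb_scale)
qed

text \<open>Cayley--Hamilton: a number that stabilises a nonzero finitely generated module is an
  eigenvalue of a matrix over the coefficient ring.\<close>

lemma integralI_module:
  assumes fin: "finite S" and nz: "b0 \<in> S" "b0 \<noteq> 0"
    and stable: "\<And>b. b \<in> S \<Longrightarrow> z * b \<in> lin_comb S"
  shows "integral z"
proof -
  define n where "n = card S"
  obtain g where g: "bij_betw g {0..<n} S"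
    using fin ex_bij_betw_nat_finite unfolding n_def by blast
  have "\<exists>c. (\<forall>b'. c b' \<in> R) \<and> z * b = (\<Sum>b'\<in>S. c b' * b')" if "b \<in> S" for b
    using stable[OF that] unfolding lin_comb_def by auto
  then obtain C where C: "\<And>b b'. b \<in> S \<Longrightarrow> C b b' \<in> R"
    "\<And>b. b \<in> S \<Longrightarrow> z * b = (\<Sum>b'\<in>S. C b b' * b')"
    by metis
  define A where "A = mat n n (\<lambda>(i, j). C (g i) (g j))"
  have A: "A \<in> carrier_mat n n" by (simp add: A_def)
  have gS: "g i \<in> S" if "i < n" for i using g that by (auto simp: bij_betw_def)
  \<comment> \<open>The list of generators is the eigenvector; \<open>b0\<close> keeps it
    nonzero.\<close>
  define v where "v = vec n g"
  have "A *\<^sub>v v = z \<cdot>\<^sub>v v"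
  proof (rule eq_vecI)
    fix i assume "i < dim_vec (z \<cdot>\<^sub>v v)"
    then have i: "i < n" by (simp add: v_def)
    have "(A *\<^sub>v v) $ i = (\<Sum>j = 0..<n. C (g i) (g j) * g j)"
      using i by (simp add: A_def v_def scalar_prod_def)
    also have "\<dots> = (\<Sum>b'\<in>S. C (g i) b' * b')"
      by (rule sum.reindex_bij_betw[OF g])
    also have "\<dots> = (z \<cdot>\<^sub>v v) $ i" using i C(2)[OF gS[OF i]] by (simp add: v_def)
    finally show "(A *\<^sub>v v) $ i = (z \<cdot>\<^sub>v v) $ i" .
  qed (simp add: A_def v_def)
  moreover have "v \<noteq> 0\<^sub>v n"
  proof -
    obtain i where "i < n" "g i = b0" using g nz(1) unfolding bij_betw_def by auto
    then have "v $ i \<noteq> (0\<^sub>v n) $ i" using nz(2) by (simp add: v_def)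
    then show ?thesis by auto
  qed
  ultimately have "eigenvalue A z"
    unfolding eigenvalue_def eigenvector_def using A by (intro exI[of _ v]) (auto simp: v_def)
  then have "poly (char_poly A) z = 0" using eigenvalue_root_char_poly[OF A] by simp
  moreover have "char_poly A \<in> polys"
    by (rule char_poly_mem_polys[OF A]) (auto simp: A_def C(1) gS)
  ultimately show ?thesis
    using degree_monic_char_poly[OF A] unfolding integral_def by blast
qed

text \<open>The monomials in \<open>x\<close> and \<open>y\<close> with exponents below the degrees
  of the two monic equations span a module containing 1. It is stable under \<open>x\<close> and
  \<open>y\<close>, hence under their sum and product, and \<open>integralI_module\<close>
  applies.\<close>

lemma integral_add_mult:
  assumes "integral x" "integral y"
  shows "integral (x + y)" "integral (x * y)"
proof -
  from assms obtain p q where p: "p \<in> polys" "lead_coeff p = 1" "poly p x = 0"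
    and q: "q \<in> polys" "lead_coeff q = 1" "poly q y = 0" unfolding integral_def by auto
  define m where "m = degree p"
  define n where "n = degree q"
  have deg_pos: "degree r > 0" if "lead_coeff r = 1" "poly r a = 0" for r :: "'a poly" and a
    using that by (intro Nat.gr0I) (auto elim: degree_eq_zeroE)
  have mn: "m > 0" "n > 0" using deg_pos p q by (auto simp: m_def n_def)
  \<comment> \<open>The monic relation expresses the top power through lower ones, which brings an
    overflowing exponent back below the degree.\<close>
  have top: "a ^ degree r = (\<Sum>i<degree r. - coeff r i * a ^ i)"
    if "lead_coeff r = 1" "poly r a = 0" for r :: "'a poly" and a
  proof -
    have "0 = (\<Sum>i\<le>degree r. coeff r i * a ^ i)" using that(2) by (simp add: poly_altdef)
    also have "\<dots> = (\<Sum>i<degree r. coeff r i * a ^ i) + a ^ degree r"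
      using that(1) by (simp add: lessThan_Suc_atMost[symmetric])
    finally show ?thesis by (simp add: sum_negf eq_neg_iff_add_eq_0 add.commute)
  qed
  \<comment> \<open>Different exponent pairs may give the same number; merging them leaves the span
    unchanged.\<close>
  define S where "S = (\<lambda>(i, j). x ^ i * y ^ j) ` ({..<m} \<times> {..<n})"
  have fin: "finite S" by (simp add: S_def)
  have base: "x ^ i * y ^ j \<in> lin_comb S" if "i < m" "j < n" for i j
    using that by (intro lin_comb_base[OF fin]) (auto simp: S_def)
  have "x ^ 0 * y ^ 0 \<in> S" unfolding S_def using mn by (auto intro!: image_eqI[of _ _ "(0, 0)"])
  then have one: "1 \<in> S" by simp
  have x: "x * b \<in> lin_comb S" if b: "b \<in> S" for b
  proof -
    obtain i j where ij: "i < m" "j < n" "b = x ^ i * y ^ j" using b by (auto simp: S_def)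
    show ?thesis
    proof (cases "Suc i = m")
      case True
      have "x * b = x ^ m * y ^ j" by (simp add: ij(3) True[symmetric])
      also have "\<dots> = (\<Sum>i<m. - coeff p i * (x ^ i * y ^ j))"
        using top[OF p(2,3)] by (simp add: m_def sum_distrib_right mult.assoc)
      also have "\<dots> \<in> lin_comb S" using p(1) ij base
        by (intro lin_comb_sum lin_comb_scale[OF minus_mem]) (auto simp: polys_def)
      finally show ?thesis .
    next
      case False
      then show ?thesis using base[of "Suc i" j] ij by (simp add: mult.assoc)
    qed
  qed
  have y: "y * b \<in> lin_comb S" if b: "b \<in> S" for b
  proof -
    obtain i j where ij: "i < m" "j < n" "b = x ^ i * y ^ j" using b by (auto simp: S_def)
    show ?thesis
    proof (cases "Suc j = n")
      case True
      have "y * b = x ^ i * y ^ n" by (simp add: ij(3) True[symmetric])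
      also have "\<dots> = (\<Sum>j<n. - coeff q j * (x ^ i * y ^ j))"
        using top[OF q(2,3)] by (simp add: n_def sum_distrib_left mult_ac)
      also have "\<dots> \<in> lin_comb S" using q(1) ij base
        by (intro lin_comb_sum lin_comb_scale[OF minus_mem]) (auto simp: polys_def)
      finally show ?thesis .
    next
      case False
      then show ?thesis using base[of i "Suc j"] ij by (simp add: mult_ac)
    qed
  qed
  show "integral (x + y)"
    by (rule integralI_module[OF fin one]) (auto simp: distrib_right x y intro!: lin_comb_add)
  show "integral (x * y)"
    by (rule integralI_module[OF fin one]) (simp_all add: mult.assoc lin_comb_mult[OF x y])
qed

end

interpretation int_coeffs: coefficient_ring "\<int> :: 'a :: field_char_0 set"
  by unfold_locales auto

interpretation rat_coeffs: coefficient_ring "\<rat> :: 'a :: field_char_0 set"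
  by unfold_locales auto

lemma algebraic_int_iff_integral: "algebraic_int x \<longleftrightarrow> int_coeffs.integral x"
  unfolding int_coeffs.integral_def int_coeffs.polys_def by (auto simp: algebraic_int.simps)

lemma algebraic_iff_integral: "algebraic x \<longleftrightarrow> rat_coeffs.integral x"
proof
  assume "algebraic x"
  then obtain p where p: "\<forall>i. coeff p i \<in> \<rat>" "p \<noteq> 0" "poly p x = 0"
    by (auto simp: algebraic_altdef)
  then have "smult (inverse (lead_coeff p)) p \<in> rat_coeffs.polys"
    by (auto simp: rat_coeffs.polys_def)
  then show "rat_coeffs.integral x"
    unfolding rat_coeffs.integral_def using p by (intro bexI) auto
next
  assume "rat_coeffs.integral x"
  then show "algebraic x"
    unfolding rat_coeffs.integral_def rat_coeffs.polys_def algebraic_altdef by auto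
qed

lemma algebraic_int_add: "\<lbrakk>algebraic_int x; algebraic_int y\<rbrakk> \<Longrightarrow> algebraic_int (x + y :: 'a :: field_char_0)"
  and algebraic_int_mult: "\<lbrakk>algebraic_int x; algebraic_int y\<rbrakk> \<Longrightarrow> algebraic_int (x * y :: 'a :: field_char_0)"
  by (simp_all add: algebraic_int_iff_integral int_coeffs.integral_add_mult)

lemma algebraic_add: "\<lbrakk>algebraic x; algebraic y\<rbrakk> \<Longrightarrow> algebraic (x + y :: 'a :: field_char_0)"
  and algebraic_mult: "\<lbrakk>algebraic x; algebraic y\<rbrakk> \<Longrightarrow> algebraic (x * y :: 'a :: field_char_0)"
  by (simp_all add: algebraic_iff_integral rat_coeffs.integral_add_mult)

lemma algebraic_diff: "\<lbrakk>algebraic x; algebraic y\<rbrakk> \<Longrightarrow> algebraic (x - y :: 'a :: field_char_0)"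
  using algebraic_add[of x "- y"] by simp

lemma algebraic_int_diff:
  "\<lbrakk>algebraic_int x; algebraic_int y\<rbrakk> \<Longrightarrow> algebraic_int (x - y :: 'a :: field_char_0)"
  using algebraic_int_add[of x "- y"] by simp

section \<open>Embeddings and conjugates\<close>

text \<open>These functions stand for the embeddings of the algebraic numbers into the complex
  numbers. HOL functions are total, so the laws are imposed on algebraic arguments and the values
  elsewhere are arbitrary.\<close>

locale algebraic_embedding =
  fixes \<sigma> :: "complex \<Rightarrow> complex"
  assumes hom_1: "\<sigma> 1 = 1"
    and hom_add: "\<lbrakk>algebraic x; algebraic y\<rbrakk> \<Longrightarrow> \<sigma> (x + y) = \<sigma> x + \<sigma> y"
    and hom_mult: "\<lbrakk>algebraic x; algebraic y\<rbrakk> \<Longrightarrow> \<sigma> (x * y) = \<sigma> x * \<sigma> y"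
begin

lemma hom_0: "\<sigma> 0 = 0"
  using hom_add[of 0 0] by simp

lemma hom_minus: "algebraic x \<Longrightarrow> \<sigma> (- x) = - \<sigma> x"
  using hom_add[of x "- x"] by (simp add: hom_0 eq_neg_iff_add_eq_0 add.commute)

lemma hom_diff: "\<lbrakk>algebraic x; algebraic y\<rbrakk> \<Longrightarrow> \<sigma> (x - y) = \<sigma> x - \<sigma> y"
  using hom_add[of x "- y"] by (simp add: hom_minus)

lemma hom_of_nat: "\<sigma> (of_nat n) = of_nat n"
  by (induction n) (simp_all add: hom_0 hom_1 hom_add)

lemma hom_numeral: "\<sigma> (numeral n) = numeral n"
  using hom_of_nat[of "numeral n"] by simp

lemma hom_of_int: "\<sigma> (of_int n) = of_int n"
  by (cases n rule: int_cases2) (simp_all add: hom_of_nat hom_minus)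

lemma hom_inverse:
  assumes "algebraic x"
  shows "\<sigma> (inverse x) = inverse (\<sigma> x)"
proof (cases "x = 0")
  case False
  then have "\<sigma> x * \<sigma> (inverse x) = 1"
    using hom_mult[of x "inverse x"] assms by (simp add: hom_1 algebraic_inverse)
  then show ?thesis by (metis inverse_unique)
qed (simp add: hom_0)

lemma hom_eq_0_iff: "algebraic x \<Longrightarrow> \<sigma> x = 0 \<longleftrightarrow> x = 0"
  using hom_mult[of x "inverse x"] by (cases "x = 0") (auto simp: hom_0 hom_1 algebraic_inverse)

lemma hom_rat:
  assumes "x \<in> \<rat>"
  shows "\<sigma> x = x"
proof -
  from assms obtain a b where x: "x = of_int a * inverse (of_int b)"
    by (metis Rats_cases' divide_inverse)
  show ?thesis unfolding x
    by (subst hom_mult) (auto simp: hom_of_int hom_inverse intro: algebraic_inverse)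
qed

text \<open>Algebraicity of the value is carried along because the induction step applies
  \<open>hom_add\<close> and \<open>hom_mult\<close>, which demand algebraic arguments.\<close>

lemma hom_poly:
  assumes "p \<in> rat_coeffs.polys" "algebraic x"
  shows "algebraic (poly p x) \<and> \<sigma> (poly p x) = poly p (\<sigma> x)"
  using assms(1)
proof (induction p)
  case (pCons a p)
  then have "coeff (pCons a p) i \<in> \<rat>" for i unfolding rat_coeffs.polys_def by blast
  from this[of 0] this[of "Suc _"] have "a \<in> \<rat>" "p \<in> rat_coeffs.polys"
    by (auto simp: rat_coeffs.polys_def)
  then show ?case using pCons.IH assms(2)
    by (simp add: hom_add hom_mult hom_rat rat_imp_algebraic algebraic_add algebraic_mult)
qed (simp add: hom_0)

lemma hom_algebraic_int:
  assumes "algebraic_int x"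
  shows "algebraic_int (\<sigma> x)"
proof -
  from assms obtain p where p: "lead_coeff p = 1" "\<forall>i. coeff p i \<in> \<int>" "poly p x = 0"
    by (auto elim: algebraic_int.cases)
  then have "p \<in> rat_coeffs.polys" unfolding rat_coeffs.polys_def using Ints_subset_Rats by auto
  then have "poly p (\<sigma> x) = 0"
    using hom_poly[of p x] p(3) algebraic_int_imp_algebraic[OF assms] by (simp add: hom_0)
  with p show ?thesis by (intro algebraic_int.intros)
qed

end

text \<open>Field homomorphisms between subfields of the complex numbers, given by their graphs, so
  that Zorn's lemma applies to the inclusion order.\<close>

locale partial_embedding =
  fixes G :: "(complex \<times> complex) set"
  assumes algebraic_dom: "(a, b) \<in> G \<Longrightarrow> algebraic a"
    and rat_graph: "r \<in> \<rat> \<Longrightarrow> (r, r) \<in> G"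
    and diff_graph: "\<lbrakk>(a, b) \<in> G; (c, d) \<in> G\<rbrakk> \<Longrightarrow> (a - c, b - d) \<in> G"
    and mult_graph: "\<lbrakk>(a, b) \<in> G; (c, d) \<in> G\<rbrakk> \<Longrightarrow> (a * c, b * d) \<in> G"
    and zero_graph: "(0, b) \<in> G \<Longrightarrow> b = 0"
begin

lemma add_graph: "\<lbrakk>(a, b) \<in> G; (c, d) \<in> G\<rbrakk> \<Longrightarrow> (a + c, b + d) \<in> G"
  using diff_graph[of a b "- c" "- d"] diff_graph[of 0 0 c d] rat_graph[of 0] by simp

lemma sum_graph: "(\<And>i. i \<in> A \<Longrightarrow> (f i, g i) \<in> G) \<Longrightarrow> (\<Sum>i\<in>A. f i, \<Sum>i\<in>A. g i) \<in> G"
  by (induction A rule: infinite_finite_induct) (auto intro: add_graph rat_graph)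

lemma unique_graph: "\<lbrakk>(a, b) \<in> G; (a, c) \<in> G\<rbrakk> \<Longrightarrow> b = c"
  using diff_graph[of a b a c] zero_graph[of "b - c"] by simp

lemma poly_graph:
  assumes "(a, b) \<in> G" "p \<in> rat_coeffs.polys"
  shows "(poly p a, poly p b) \<in> G"
  using assms(2)
proof (induction p)
  case (pCons r p)
  then have "coeff (pCons r p) i \<in> \<rat>" for i unfolding rat_coeffs.polys_def by blast
  from this[of 0] this[of "Suc _"] have "r \<in> \<rat>" "p \<in> rat_coeffs.polys"
    by (auto simp: rat_coeffs.polys_def)
  then show ?case using pCons.IH assms(1) by (simp add: add_graph mult_graph rat_graph)
qed (simp add: rat_graph)

text \<open>Inverses come for free, as the inverse of an algebraic number is a polynomial in it.\<close>

lemma inverse_graph: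
  assumes "(a, b) \<in> G" "a \<noteq> 0"
  shows "(inverse a, inverse b) \<in> G"
proof -
  obtain p :: "int poly" where p: "coeff p 0 \<noteq> 0" "poly (map_poly of_int p) a = 0"
    using algebraicE'_nonzero[OF algebraic_dom[OF assms(1)] assms(2)] by metis
  obtain c q where pq: "map_poly of_int p = pCons (c :: complex) q" by (rule pCons_cases)
  have coeffs: "coeff (pCons c q) i \<in> \<rat>" for i
    by (simp add: pq[symmetric] coeff_map_poly)
  have c: "c \<in> \<rat>" "q \<in> rat_coeffs.polys"
    using coeffs[of 0] coeffs[of "Suc _"] by (auto simp: rat_coeffs.polys_def)
  have "c = of_int (coeff p 0)" using pq by (metis coeff_map_poly coeff_pCons_0 of_int_0)
  then have "c \<noteq> 0" using p(1) by simp
  \<comment> \<open>Dividing the relation \<open>c + a * poly q a = 0\<close> by \<open>c\<close>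
    makes \<open>poly r a\<close> the inverse of \<open>a\<close>. The graph transports this
    identity to \<open>b\<close>, since 1 is paired only with 1.\<close>
  define r where "r = smult (- inverse c) q"
  have r: "r \<in> rat_coeffs.polys" using c by (auto simp: r_def rat_coeffs.polys_def)
  have "c + a * poly q a = 0" using p(2) pq by simp
  then have "a * poly q a = - c" by (simp add: add_eq_0_iff)
  moreover have "a * poly r a = - inverse c * (a * poly q a)" by (simp add: r_def)
  ultimately have "a * poly r a = 1" using \<open>c \<noteq> 0\<close> by simp
  have "(a * poly r a, b * poly r b) \<in> G" by (intro mult_graph poly_graph assms(1) r)
  then have "b * poly r b = 1"
    using unique_graph[OF _ rat_graph[of 1]] \<open>a * poly r a = 1\<close> by force
  with \<open>a * poly r a = 1\<close> have "inverse a = poly r a" "inverse b = poly r b"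
    by (simp_all add: inverse_unique)
  then show ?thesis using poly_graph[OF assms(1) r] by simp
qed

text \<open>Here \<open>q\<close> is the image of \<open>p\<close> under the homomorphism with graph
  \<open>G\<close>, applied to the coefficients.\<close>

definition poly_pairs :: "(complex poly \<times> complex poly) set" where
  "poly_pairs = {(p, q). \<forall>i. (coeff p i, coeff q i) \<in> G}"

text \<open>This is the only candidate for the graph of an extension that sends \<open>x\<close> to
  \<open>y\<close>; for arbitrary \<open>y\<close> it need not be single-valued.\<close>

definition adjoin :: "complex \<Rightarrow> complex \<Rightarrow> (complex \<times> complex) set" where
  "adjoin x y = {(poly p x, poly q y) | p q. (p, q) \<in> poly_pairs}"

lemma poly_pairs_const: "(a, b) \<in> G \<Longrightarrow> ([:a:], [:b:]) \<in> poly_pairs"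
  by (auto simp: poly_pairs_def coeff_pCons rat_graph split: nat.split)

lemma poly_pairs_var: "([:0, 1:], [:0, 1:]) \<in> poly_pairs"
  by (auto simp: poly_pairs_def coeff_pCons rat_graph split: nat.split)

lemma poly_pairs_diff:
  "\<lbrakk>(p, q) \<in> poly_pairs; (p', q') \<in> poly_pairs\<rbrakk> \<Longrightarrow> (p - p', q - q') \<in> poly_pairs"
  by (auto simp: poly_pairs_def diff_graph)

lemma poly_pairs_mult:
  "\<lbrakk>(p, q) \<in> poly_pairs; (p', q') \<in> poly_pairs\<rbrakk> \<Longrightarrow> (p * p', q * q') \<in> poly_pairs"
  by (auto simp: poly_pairs_def coeff_mult intro!: sum_graph mult_graph)

lemma base_subset_adjoin: "G \<subseteq> adjoin x y"
proof
  fix z assume "z \<in> G"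
  then have "(fst z, snd z) \<in> G" by simp
  from poly_pairs_const[OF this] show "z \<in> adjoin x y"
    unfolding adjoin_def by (cases z) force
qed

lemma mem_adjoin: "(x, y) \<in> adjoin x y"
  using poly_pairs_var unfolding adjoin_def by force

lemma poly_algebraic:
  assumes "algebraic x" "\<And>i. algebraic (coeff p i)"
  shows "algebraic (poly p x)"
  using assms(2)
proof (induction p)
  case (pCons a p)
  from pCons.prems[of 0] pCons.prems[of "Suc _"] have "algebraic a" "algebraic (poly p x)"
    using pCons.IH by auto
  then show ?case by (simp add: algebraic_add algebraic_mult assms(1))
qed simp

text \<open>The assumption \<open>compat\<close> is the well-definedness of the extended map.
  Polynomials in \<open>x\<close> suffice as its domain, since \<open>inverse_graph\<close> supplies
  the inverses.\<close>

lemma partial_embedding_adjoin: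
  assumes "algebraic x"
    and compat: "\<And>p q. \<lbrakk>(p, q) \<in> poly_pairs; poly p x = 0\<rbrakk> \<Longrightarrow> poly q y = 0"
  shows "partial_embedding (adjoin x y)"
proof
  show "algebraic a" if "(a, b) \<in> adjoin x y" for a b
    using that assms(1) algebraic_dom unfolding adjoin_def poly_pairs_def
    by (auto intro!: poly_algebraic)
  show "(r, r) \<in> adjoin x y" if "r \<in> \<rat>" for r
    using rat_graph[OF that] base_subset_adjoin by blast
  show "b = 0" if "(0, b) \<in> adjoin x y" for b
    using that compat unfolding adjoin_def by auto
  show "(a - c, b - d) \<in> adjoin x y" "(a * c, b * d) \<in> adjoin x y"
    if "(a, b) \<in> adjoin x y" "(c, d) \<in> adjoin x y" for a b c d
  proof -
    from that obtain p q p' q' where pq: "a = poly p x" "b = poly q y" "(p, q) \<in> poly_pairs"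
      "c = poly p' x" "d = poly q' y" "(p', q') \<in> poly_pairs" unfolding adjoin_def by auto
    show "(a - c, b - d) \<in> adjoin x y" unfolding adjoin_def mem_Collect_eq
      using pq poly_pairs_diff[OF pq(3,6)]
      by (intro exI[of _ "p - p'"] exI[of _ "q - q'"]) auto
    show "(a * c, b * d) \<in> adjoin x y" unfolding adjoin_def mem_Collect_eq
      using pq poly_pairs_mult[OF pq(3,6)]
      by (intro exI[of _ "p * p'"] exI[of _ "q * q'"]) auto
  qed
qed

text \<open>A suitable \<open>y\<close> is any root of the image of the minimal polynomial of
  \<open>x\<close> over the domain of \<open>G\<close>.\<close>

lemma adjoin_algebraic:
  assumes x: "algebraic x"
  shows "\<exists>y. partial_embedding (adjoin x y)"
proof -
  \<comment> \<open>A nonzero polynomial of least degree that vanishes at \<open>x\<close> serves as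
    minimal polynomial; a rational one shows that some exists.\<close>
  define P where "P = (\<lambda>n. \<exists>p q. (p, q) \<in> poly_pairs \<and> p \<noteq> 0 \<and> poly p x = 0 \<and> degree p = n)"
  obtain f where f: "\<forall>i. coeff f i \<in> \<rat>" "f \<noteq> 0" "poly f x = 0"
    using x unfolding algebraic_altdef by auto
  then have "P (degree f)" unfolding P_def poly_pairs_def using rat_graph by blast
  then have "P (LEAST n. P n)" by (rule LeastI)
  then obtain m m' where m: "(m, m') \<in> poly_pairs" "m \<noteq> 0" "poly m x = 0"
    "degree m = (LEAST n. P n)" unfolding P_def by auto
  have least: "degree m \<le> degree p" if "(p, q) \<in> poly_pairs" "p \<noteq> 0" "poly p x = 0" for p q
    unfolding m(4) using that by (intro Least_le) (auto simp: P_def)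
  have "degree m > 0" using m(2,3) by (intro Nat.gr0I) (auto elim!: degree_eq_zeroE)
  define c where "c = lead_coeff m"
  define d where "d = coeff m' (degree m)"
  have cd: "(c, d) \<in> G" using m(1) by (auto simp: poly_pairs_def c_def d_def)
  have "c \<noteq> 0" using m(2) by (simp add: c_def)
  from inverse_graph[OF cd this] have icd: "(inverse c, inverse d) \<in> G" .
  \<comment> \<open>The leading coefficient must survive in the image: this gives \<open>m'\<close>
    positive degree and hence a complex root.\<close>
  have "d \<noteq> 0"
  proof
    assume "d = 0"
    then have "(inverse c * c, 0) \<in> G" using mult_graph[OF icd cd] by simp
    then show False using unique_graph[OF _ rat_graph[of 1]] \<open>c \<noteq> 0\<close> by fastforce
  qed
  then have "degree m' > 0" using \<open>degree m > 0\<close> le_degree[of m' "degree m"] by (simp add: d_def)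
  then obtain y where y: "poly m' y = 0"
    using fundamental_theorem_of_algebra[of m'] constant_degree[of m'] by auto
  have "poly q y = 0" if "(p, q) \<in> poly_pairs" "poly p x = 0" for p q
    using that
  proof (induction "degree p" arbitrary: p q rule: less_induct)
    case less
    show ?case
    proof (cases "p = 0")
      case True
      then have "coeff q i = 0" for i
        using less.prems(1) zero_graph by (auto simp: poly_pairs_def)
      then have "q = 0" by (simp add: poly_eq_iff)
      then show ?thesis by simp
    next
      case False
      with less.prems have le: "degree m \<le> degree p" using least by blast
      define k where "k = degree p - degree m"
      define a where "a = lead_coeff p"
      define b where "b = coeff q (degree p)"
      have ab: "(a, b) \<in> G" using less.prems(1) by (auto simp: poly_pairs_def a_def b_def)
      \<comment> \<open>One step of long division by \<open>m\<close>, mirrored by \<open>m'\<close>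
        on the images. The values at \<open>x\<close> and \<open>y\<close> do not change, because
        \<open>m\<close> and \<open>m'\<close> vanish there.\<close>
      define p' where "p' = p - monom (a * inverse c) k * m"
      define q' where "q' = q - monom (b * inverse d) k * m'"
      have "(monom (a * inverse c) k, monom (b * inverse d) k) \<in> poly_pairs"
        using mult_graph[OF ab icd] rat_graph[of 0] by (auto simp: poly_pairs_def)
      then have pairs: "(p', q') \<in> poly_pairs"
        unfolding p'_def q'_def by (intro poly_pairs_diff poly_pairs_mult less.prems m(1))
      have root: "poly p' x = 0" using less.prems m(3) by (simp add: p'_def)
      have "degree (monom (a * inverse c) k * m) \<le> degree p"
        using degree_mult_le[of "monom (a * inverse c) k" m] degree_monom_le[of "a * inverse c" k] le
        by (simp add: k_def)
      moreover have "coeff p' (degree p) = 0"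
        using le \<open>c \<noteq> 0\<close> by (simp add: p'_def coeff_monom_mult k_def a_def c_def)
      ultimately have "degree p' < degree p \<or> p' = 0"
        using le \<open>degree m > 0\<close> unfolding p'_def
        by (metis (no_types, lifting) degree_diff_le eq_zero_or_degree_less order.refl)
      then have "poly q' y = 0"
      proof
        assume "degree p' < degree p"
        then show ?thesis using less.hyps pairs root by blast
      next
        assume "p' = 0"
        then have "coeff q' i = 0" for i
          using pairs zero_graph by (auto simp: poly_pairs_def)
        then have "q' = 0" by (simp add: poly_eq_iff)
        then show ?thesis by simp
      qed
      then show ?thesis using y by (simp add: q'_def)
    qed
  qed
  then show ?thesis using partial_embedding_adjoin[OF x] by blast
qed

text \<open>Zorn's lemma gives a maximal extension of the graph. An algebraic number missing from
  its domain could be added by \<open>adjoin_algebraic\<close>.\<close>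

lemma extend_to_embedding:
  "\<exists>\<sigma>. algebraic_embedding \<sigma> \<and> (\<forall>(a, b) \<in> G. \<sigma> a = b)"
proof -
  define \<A> where "\<A> = {H. partial_embedding H \<and> G \<subseteq> H}"
  have "\<exists>M\<in>\<A>. \<forall>H\<in>\<A>. M \<subseteq> H \<longrightarrow> H = M"
  proof (rule subset_Zorn_nonempty)
    show "\<A> \<noteq> {}" using partial_embedding_axioms by (auto simp: \<A>_def)
    fix C assume C: "C \<noteq> {}" "subset.chain \<A> C"
    have emb: "partial_embedding H" "G \<subseteq> H" if "H \<in> C" for H
      using C(2) that by (auto simp: subset.chain_def \<A>_def)
    \<comment> \<open>Closure under differences and products involves two pairs at once; members of
      a chain are comparable, so one member contains both.\<close>
    have common: "\<exists>H\<in>C. u \<in> H \<and> v \<in> H" if "u \<in> \<Union>C" "v \<in> \<Union>C" for u v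
    proof -
      from that obtain H H' where H: "H \<in> C" "u \<in> H" "H' \<in> C" "v \<in> H'" by blast
      then have "H \<subseteq> H' \<or> H' \<subseteq> H" using C(2) unfolding subset_chain_def by blast
      then show ?thesis using H by blast
    qed
    have "partial_embedding (\<Union>C)"
    proof
      show "algebraic a" if "(a, b) \<in> \<Union>C" for a b
        using that emb(1) by (auto dest: partial_embedding.algebraic_dom)
      show "(r, r) \<in> \<Union>C" if "r \<in> \<rat>" for r
        using that C(1) emb(1) partial_embedding.rat_graph by blast
      show "b = 0" if "(0, b) \<in> \<Union>C" for b
        using that emb(1) by (auto dest: partial_embedding.zero_graph)
      show "(a - c, b - d) \<in> \<Union>C" "(a * c, b * d) \<in> \<Union>C"
        if "(a, b) \<in> \<Union>C" "(c, d) \<in> \<Union>C" for a b c d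
        using common[OF that] emb(1)
        by (blast dest: partial_embedding.diff_graph partial_embedding.mult_graph)+
    qed
    moreover have "G \<subseteq> \<Union>C" using C(1) emb(2) by blast
    ultimately show "\<Union>C \<in> \<A>" by (simp add: \<A>_def)
  qed
  then obtain M where "M \<in> \<A>" and max: "\<forall>H\<in>\<A>. M \<subseteq> H \<longrightarrow> H = M" by auto
  then have M: "partial_embedding M" "G \<subseteq> M" by (simp_all add: \<A>_def)
  have maximal: "H = M" if "partial_embedding H" "M \<subseteq> H" for H
    using max that M(2) subset_trans[OF M(2) that(2)] by (simp add: \<A>_def)
  interpret M: partial_embedding M by (rule M(1))
  have "\<exists>b. (a, b) \<in> M" if a: "algebraic a" for a
  proof -
    obtain b where b: "partial_embedding (M.adjoin a b)" using M.adjoin_algebraic[OF a] by blast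
    then have "M.adjoin a b = M" using maximal M.base_subset_adjoin by blast
    then show ?thesis using M.mem_adjoin by metis
  qed
  then obtain \<sigma> where \<sigma>: "\<And>a. algebraic a \<Longrightarrow> (a, \<sigma> a) \<in> M" by metis
  have eq: "\<sigma> a = b" if "(a, b) \<in> M" for a b
    using that M.unique_graph \<sigma> M.algebraic_dom by blast
  have "algebraic_embedding \<sigma>"
  proof
    show "\<sigma> 1 = 1" by (rule eq) (simp add: M.rat_graph)
    show "\<sigma> (x + y) = \<sigma> x + \<sigma> y" "\<sigma> (x * y) = \<sigma> x * \<sigma> y" if "algebraic x" "algebraic y" for x y
      using that by (auto intro!: eq M.add_graph M.mult_graph \<sigma>)
  qed
  then show ?thesis using eq M(2) by blast
qed

end

section \<open>Minimal polynomials, conjugates and norms\<close>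

interpretation of_rat_poly: map_poly_inj_idom_hom "of_rat :: rat \<Rightarrow> complex"
  by unfold_locales (auto simp: of_rat_add of_rat_mult)

lemma irreducible_poly_root:
  fixes x :: complex
  assumes "algebraic x"
  obtains p :: "rat poly" where "Factorial_Ring.irreducible p" "poly (map_poly of_rat p) x = 0"
proof -
  have "\<exists>p :: rat poly. Factorial_Ring.irreducible p \<and> poly (map_poly of_rat p) x = 0"
    if "poly (map_poly of_rat f) x = 0" "f \<noteq> 0" for f :: "rat poly"
    using that
  proof (induction "degree f" arbitrary: f rule: less_induct)
    case less
    have deg: "degree f > 0"
      using less.prems by (intro Nat.gr0I) (auto elim!: degree_eq_zeroE simp: map_poly_pCons)
    show ?case
    proof (cases "Factorial_Ring.irreducible f")
      case False
      have "\<not> f dvd 1" using deg less.prems(2) by (simp add: is_unit_iff_degree)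
      with False obtain g h where gh: "f = g * h" "\<not> g dvd 1" "\<not> h dvd 1"
        using less.prems(2) unfolding Factorial_Ring.irreducible_def by blast
      then have "g \<noteq> 0" "h \<noteq> 0" using less.prems(2) by auto
      then have smaller: "degree g < degree f" "degree h < degree f"
        using gh by (auto simp: is_unit_iff_degree degree_mult_eq)
      then have "poly (map_poly of_rat g) x = 0 \<or> poly (map_poly of_rat h) x = 0"
        using less.prems(1) unfolding gh(1) by (simp add: of_rat_poly.hom_mult)
      then show ?thesis using less.hyps[OF smaller(1)] less.hyps[OF smaller(2)] \<open>g \<noteq> 0\<close> \<open>h \<noteq> 0\<close> by blast
    qed (use less.prems in blast)
  qed
  moreover obtain g :: "int poly" where g: "g \<noteq> 0" "poly (map_poly of_int g) x = 0"
    using algebraicE'[OF assms] by metis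
  have "map_poly of_rat (map_poly of_int g) = (map_poly of_int g :: complex poly)"
    by (simp add: map_poly_map_poly comp_def)
  then have "poly (map_poly of_rat (map_poly of_int g)) x = 0" using g by simp
  moreover have "map_poly of_int g \<noteq> (0 :: rat poly)" using g by simp
  ultimately show ?thesis using that by blast
qed

lemma algebraic_embedding_conjugate:
  assumes "algebraic_embedding \<sigma>" "algebraic x"
  shows "Defs.conjugate x (\<sigma> x)"
proof -
  interpret algebraic_embedding \<sigma> by fact
  obtain p :: "rat poly" where p: "Factorial_Ring.irreducible p" "poly (map_poly of_rat p) x = 0"
    using irreducible_poly_root[OF assms(2)] by blast
  have "map_poly of_rat p \<in> rat_coeffs.polys" by (auto simp: rat_coeffs.polys_def coeff_map_poly)
  from hom_poly[OF this assms(2)] p show ?thesis unfolding Defs.conjugate_def by (auto simp: hom_0)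
qed

lemma rat_polys_cases:
  assumes "p \<in> rat_coeffs.polys"
  obtains q where "p = map_poly of_rat q"
proof -
  from assms have "\<forall>i. \<exists>r. coeff p i = of_rat r"
    unfolding rat_coeffs.polys_def by (auto elim: Rats_cases)
  then obtain f where f: "\<And>i. coeff p i = of_rat (f i)" by metis
  have "p = map_poly of_rat (map_poly (\<lambda>c. THE r. c = of_rat r) p)"
    by (rule poly_eqI) (auto simp: coeff_map_poly f)
  then show ?thesis using that by blast
qed

text \<open>The identity on the rationals extends by sending \<open>x\<close> to \<open>y\<close>,
  because the irreducible \<open>p\<close> divides every rational polynomial that vanishes at
  \<open>x\<close>. With \<open>algebraic_embedding_conjugate\<close> this identifies conjugates
  with images under embeddings.\<close>

lemma conjugate_embedding:
  assumes "Defs.conjugate x y"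
  obtains \<sigma> where "algebraic_embedding \<sigma>" "\<sigma> x = y"
proof -
  from assms obtain p :: "rat poly" where p: "Factorial_Ring.irreducible p"
    "poly (map_poly of_rat p) x = 0" "poly (map_poly of_rat p) y = 0"
    unfolding Defs.conjugate_def by auto
  have "p \<noteq> 0" using p(1) by auto
  define G where "G = {(r :: complex, r) | r. r \<in> \<rat>}"
  interpret partial_embedding G
    by unfold_locales (auto simp: G_def rat_imp_algebraic)
  have x: "algebraic x"
    using p(2) \<open>p \<noteq> 0\<close> by (intro algebraicI'[of "map_poly of_rat p"]) (auto simp: coeff_map_poly)
  have "poly g y = 0" if fg: "(f, g) \<in> poly_pairs" and root: "poly f x = 0" for f g
  proof -
    have "\<forall>i. (coeff f i, coeff g i) \<in> G" using fg by (simp add: poly_pairs_def)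
    then have "f = g" "f \<in> rat_coeffs.polys"
      by (auto simp: G_def poly_eq_iff rat_coeffs.polys_def)
    then obtain q where q: "g = map_poly of_rat q" "f = map_poly of_rat q"
      using rat_polys_cases by metis
    have "p dvd q"
    proof (rule ccontr)
      assume "\<not> p dvd q"
      \<comment> \<open>A Bezout identity, evaluated at the common root \<open>x\<close>, would read
        0 = 1.\<close>
      then have "coprime p q" using p(1)
        by (simp add: field_poly_irreducible_imp_prime prime_elem_imp_coprime)
      then obtain a b where "a * p + b * q = 1" by (metis bezout_coefficients_fst_snd coprime_iff_gcd_eq_1)
      then have "map_poly of_rat (a * p + b * q) = (1 :: complex poly)" by simp
      then have "poly (map_poly of_rat a * map_poly of_rat p + map_poly of_rat b * map_poly of_rat q) x = 1"
        by (simp add: of_rat_poly.hom_add of_rat_poly.hom_mult)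
      then show False using p(2) root q(2) by simp
    qed
    then show ?thesis using p(3) by (auto simp: q(1) of_rat_poly.hom_mult elim!: dvdE)
  qed
  then have "partial_embedding (adjoin x y)" by (rule partial_embedding_adjoin[OF x])
  from partial_embedding.extend_to_embedding[OF this] mem_adjoin that show ?thesis by fastforce
qed

text \<open>Its norm would be a rational integer of absolute value less than one.\<close>

lemma algebraic_int_conjugates_small:
  assumes w: "algebraic_int w"
    and small: "\<And>\<sigma>. algebraic_embedding \<sigma> \<Longrightarrow> norm (\<sigma> w) < 1"
  shows "w = 0"
proof -
  have "algebraic w" using w by blast
  then obtain p :: "rat poly" where p: "Factorial_Ring.irreducible p" "poly (map_poly of_rat p) w = 0"
    using irreducible_poly_root by blast
  define P where "P = (map_poly of_rat p :: complex poly)"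
  have "p \<noteq> 0" using p(1) by auto
  then have "P \<noteq> 0" by (simp add: P_def)
  have root: "\<exists>\<sigma>. algebraic_embedding \<sigma> \<and> \<sigma> w = r" if "r \<in># proots P" for r
  proof -
    have "poly P r = 0" using that \<open>P \<noteq> 0\<close> by simp
    then have "Defs.conjugate w r" unfolding Defs.conjugate_def using p by (auto simp: P_def)
    then show ?thesis using conjugate_embedding by metis
  qed
  \<comment> \<open>Up to sign this is the norm of \<open>w\<close>. It is rational as a quotient of
    coefficients of \<open>P\<close>, and integral as a product of negated conjugates of
    \<open>w\<close>.\<close>
  define c where "c = (\<Prod>r\<in>#proots P. - r)"
  have P: "smult (lead_coeff P) (\<Prod>r\<in>#proots P. [:- r, 1:]) = P"
    by (rule complex_poly_decompose_multiset)
  have "coeff P 0 = lead_coeff P * poly (\<Prod>r\<in>#proots P. [:- r, 1:]) 0"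
    by (subst P[symmetric]) (simp only: poly_0_coeff_0[symmetric] poly_smult)
  also have "poly (\<Prod>r\<in>#proots P. [:- r, 1:]) 0 = c"
    by (simp add: poly_prod_mset c_def image_mset.compositionality comp_def)
  finally have coeff: "coeff P 0 = lead_coeff P * c" .
  then have "c = coeff P 0 / lead_coeff P" using \<open>P \<noteq> 0\<close> by simp
  then have "c \<in> \<rat>" by (auto simp: P_def coeff_map_poly)
  moreover have "algebraic_int (\<Prod>r\<in>#A. - r)" if "\<And>r. r \<in># A \<Longrightarrow> algebraic_int r" for A :: "complex multiset"
    using that by (induction A) (auto intro!: algebraic_int_mult)
  then have "algebraic_int c" unfolding c_def
    using root w algebraic_embedding.hom_algebraic_int by blast
  ultimately have "c \<in> \<int>" by (rule rational_algebraic_int_is_int[rotated])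
  \<comment> \<open>The empty product is 1, so the strict bound needs a nonempty multiset, while the
    weak bound carries the induction.\<close>
  have "norm (\<Prod>r\<in>#A. - r) \<le> 1 \<and> (A \<noteq> {#} \<longrightarrow> norm (\<Prod>r\<in>#A. - r) < 1)"
    if "\<And>r. r \<in># A \<Longrightarrow> norm r < 1" for A :: "complex multiset"
    using that
  proof (induction A)
    case (add r A)
    then have "norm r < 1" "norm (\<Prod>r\<in>#A. - r) \<le> 1" by auto
    then have "norm r * norm (\<Prod>r\<in>#A. - r) < 1"
      by (metis linorder_not_le mult_left_le norm_ge_zero order.strict_trans1)
    then show ?case by (simp add: norm_mult)
  qed simp
  moreover have "w \<in># proots P" using p(2) \<open>P \<noteq> 0\<close> by (simp add: P_def)
  then have "proots P \<noteq> {#}" by auto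
  ultimately have "norm c < 1" unfolding c_def using root small by metis
  with \<open>c \<in> \<int>\<close> have "c = 0" by (auto elim!: Ints_cases)
  \<comment> \<open>A zero root is the image of \<open>w\<close> under some embedding, and
    embeddings are injective on algebraic numbers.\<close>
  with coeff have "0 \<in># proots P" using \<open>P \<noteq> 0\<close> by (simp add: poly_0_coeff_0)
  then obtain \<sigma> where "algebraic_embedding \<sigma>" "\<sigma> w = 0" using root by blast
  then show ?thesis using algebraic_embedding.hom_eq_0_iff \<open>algebraic w\<close> by blast
qed

section \<open>Totally real fields and quadratic extensions\<close>

lemma field_complex_ring: "Ring.field complex_ring"
  by (rule field_from_type_algebra)

interpretation complex_ring: Ring.ring complex_ring
  by (rule ring_from_type_algebra)

lemma complex_ring_simps [simp]:
  "carrier complex_ring = UNIV" "x \<otimes>\<^bsub>complex_ring\<^esub> y = x * y" "x \<oplus>\<^bsub>complex_ring\<^esub> y = x + y"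
  "\<one>\<^bsub>complex_ring\<^esub> = 1" "\<zero>\<^bsub>complex_ring\<^esub> = 0"
  by (simp_all add: ring_of_type_algebra_def)

lemma real_ring_simps [simp]:
  "carrier real_ring = UNIV" "a \<otimes>\<^bsub>real_ring\<^esub> b = a * b" "a \<oplus>\<^bsub>real_ring\<^esub> b = a + b"
  "\<one>\<^bsub>real_ring\<^esub> = 1"
  by (simp_all add: ring_of_type_algebra_def)

lemma complex_ring_a_inv [simp]: "\<ominus>\<^bsub>complex_ring\<^esub> x = - x"
  using complex_ring.minus_equality[of "- x" x] by simp

lemma complex_ring_m_inv [simp]: "x \<noteq> 0 \<Longrightarrow> inv\<^bsub>complex_ring\<^esub> x = inverse x"
  using comm_monoid.comm_inv_char[OF cring.axioms(2)[OF cring_from_type_algebra], of x "inverse x"] by simp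

lemma subfield_complex_ring_iff:
  "subfield F complex_ring \<longleftrightarrow>
     1 \<in> F \<and> (\<forall>x\<in>F. \<forall>y\<in>F. x - y \<in> F \<and> x * y \<in> F) \<and> (\<forall>x\<in>F. inverse x \<in> F)"
proof
  assume F: "subfield F complex_ring"
  note sub = subringE[OF subfieldE(1)[OF F], simplified]
  have "x - y \<in> F" if "x \<in> F" "y \<in> F" for x y
    using sub(7)[OF that(1) sub(5)[OF that(2)]] sub by simp
  moreover have "inverse x \<in> F" if "x \<in> F" for x
    using complex_ring.subfield_m_inv(1)[OF F, of x] that by (cases "x = 0") auto
  ultimately show "1 \<in> F \<and> (\<forall>x\<in>F. \<forall>y\<in>F. x - y \<in> F \<and> x * y \<in> F) \<and> (\<forall>x\<in>F. inverse x \<in> F)"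
    using sub by auto
next
  assume F: "1 \<in> F \<and> (\<forall>x\<in>F. \<forall>y\<in>F. x - y \<in> F \<and> x * y \<in> F) \<and> (\<forall>x\<in>F. inverse x \<in> F)"
  then have "0 \<in> F" by force
  then have neg: "- x \<in> F" if "x \<in> F" for x using F that by force
  have add: "x + y \<in> F" if "x \<in> F" "y \<in> F" for x y
  proof -
    have "x - (- y) \<in> F" using F neg that by blast
    then show ?thesis by simp
  qed
  show "subfield F complex_ring"
    by (intro field.subfieldI'[OF field_complex_ring] complex_ring.subringI) (use F neg add in auto)
qed

locale alg_field =
  fixes F :: "complex set"
  assumes algebraic_field: "algebraic_field F"
begin

lemma
  shows one_mem: "1 \<in> F"
    and diff_mem: "\<lbrakk>x \<in> F; y \<in> F\<rbrakk> \<Longrightarrow> x - y \<in> F"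
    and mult_mem: "\<lbrakk>x \<in> F; y \<in> F\<rbrakk> \<Longrightarrow> x * y \<in> F"
    and inverse_mem: "x \<in> F \<Longrightarrow> inverse x \<in> F"
    and algebraic_mem: "x \<in> F \<Longrightarrow> algebraic x"
  using algebraic_field
  unfolding algebraic_field_def subfield_complex_ring_iff algebraic_numbers_def by auto

sublocale coefficient_ring F
  by unfold_locales (fact one_mem diff_mem mult_mem)+

lemma of_nat_mem: "of_nat n \<in> F"
  by (induction n) (auto intro: zero_mem one_mem add_mem)

lemma numeral_mem: "numeral n \<in> F"
  using of_nat_mem[of "numeral n"] by simp

lemma rat_mem:
  assumes "r \<in> \<rat>"
  shows "r \<in> F"
proof -
  have of_int: "of_int a \<in> F" for a
    by (cases a rule: int_cases2) (auto intro: of_nat_mem minus_mem)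
  from assms obtain a b where "r = of_int a * inverse (of_int b)"
    by (metis Rats_cases' divide_inverse)
  then show ?thesis by (simp add: of_int mult_mem inverse_mem)
qed

end

text \<open>Inverses come from \<open>inverse_graph\<close>, applied to the identity on
  \<open>F\<close> seen as a partial embedding.\<close>

lemma algebraic_fieldI:
  assumes "\<And>x. x \<in> F \<Longrightarrow> algebraic x" "\<rat> \<subseteq> F"
    and "\<And>x y. \<lbrakk>x \<in> F; y \<in> F\<rbrakk> \<Longrightarrow> x - y \<in> F"
    and "\<And>x y. \<lbrakk>x \<in> F; y \<in> F\<rbrakk> \<Longrightarrow> x * y \<in> F"
  shows "algebraic_field F"
proof -
  interpret partial_embedding "{(x, x) | x. x \<in> F}"
    by unfold_locales (use assms in auto)
  have "inverse x \<in> F" if "x \<in> F" for x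
    using inverse_graph[of x x] that by (cases "x = 0") auto
  then show ?thesis
    using assms unfolding algebraic_field_def subfield_complex_ring_iff algebraic_numbers_def by auto
qed

lemma id_embedding: "algebraic_embedding (\<lambda>x. x)"
  by unfold_locales auto

text \<open>All totally real fields lie in this set, so the maximal totally real subfield of a given
  field becomes an explicit intersection.\<close>

definition totally_real_numbers :: "complex set" where
  "totally_real_numbers = {x. algebraic x \<and> (\<forall>\<sigma>. algebraic_embedding \<sigma> \<longrightarrow> \<sigma> x \<in> \<real>)}"

lemma totally_real_iff:
  "totally_real F \<longleftrightarrow> algebraic_field F \<and> F \<subseteq> totally_real_numbers"
proof -
  have "(\<forall>y. Defs.conjugate x y \<longrightarrow> y \<in> \<real>) \<longleftrightarrow> x \<in> totally_real_numbers" if "algebraic x" for x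
    unfolding totally_real_numbers_def
    using that algebraic_embedding_conjugate conjugate_embedding by (smt (verit) mem_Collect_eq)
  moreover have "algebraic x" if "algebraic_field F" "x \<in> F" for x
    using that by (rule alg_field.algebraic_mem[OF alg_field.intro])
  ultimately show ?thesis unfolding totally_real_def by blast
qed

lemma algebraic_field_inter_totally_real_numbers:
  assumes "subfield F complex_ring"
  shows "algebraic_field (F \<inter> totally_real_numbers)"
  using assms unfolding algebraic_field_def subfield_complex_ring_iff
  by (auto simp: totally_real_numbers_def algebraic_numbers_def algebraic_embedding.hom_diff
      algebraic_embedding.hom_mult algebraic_embedding.hom_inverse algebraic_embedding.hom_1
      algebraic_diff algebraic_mult intro: algebraic_inverse)

lemma maximal_totally_real_subfield_eq:
  assumes "maximal_totally_real_subfield M F" "subfield F complex_ring"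
  shows "M = F \<inter> totally_real_numbers"
proof -
  have "totally_real (F \<inter> totally_real_numbers)"
    by (simp add: totally_real_iff algebraic_field_inter_totally_real_numbers assms(2))
  moreover have "M \<subseteq> F \<inter> totally_real_numbers"
    using assms(1) unfolding maximal_totally_real_subfield_def totally_real_iff by blast
  ultimately show ?thesis
    using assms(1) unfolding maximal_totally_real_subfield_def by blast
qed

section \<open>The quadratic compositum and quadratic extensions\<close>

lemma subfield_quadratic_compositum: "subfield (quadratic_compositum F) complex_ring"
  unfolding quadratic_compositum_def by (rule field.generate_field_is_subfield[OF field_complex_ring]) simp

lemma extension_subset_quadratic_compositum:
  assumes "extension_of_degree n F E" "n \<le> 2"
  shows "E \<subseteq> quadratic_compositum F"
  unfolding quadratic_compositum_def using assms by (blast intro: generate_field.incl)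

lemma base_subset_quadratic_compositum:
  assumes "algebraic_field F"
  shows "F \<subseteq> quadratic_compositum F"
proof (rule extension_subset_quadratic_compositum)
  show "extension_of_degree 1 F F"
    using assms complex_ring.dimension_one unfolding extension_of_degree_def algebraic_field_def
    by blast
qed simp

text \<open>For \<open>s\<close> outside \<open>F\<close>, the elements \<open>a * s + b\<close>
  with \<open>a\<close> and \<open>b\<close> in \<open>F\<close> are closed under multiplication,
  because the square of \<open>s\<close> lies in \<open>F\<close>. They form one of the quadratic
  extensions that generate the compositum.\<close>

lemma sqrt_mem_quadratic_compositum:
  assumes F: "algebraic_field F" and s: "s ^ 2 \<in> F"
  shows "s \<in> quadratic_compositum F"
proof (cases "s \<in> F")
  case True
  then show ?thesis using base_subset_quadratic_compositum[OF F] by blast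
next
  case False
  interpret alg_field F by unfold_locales (rule F)
  define E where "E = complex_ring.line_extension F s F"
  have mem: "x \<in> E \<longleftrightarrow> (\<exists>a\<in>F. \<exists>b\<in>F. x = a * s + b)" for x
    by (simp add: E_def complex_ring.line_extension_mem_iff)
  have "algebraic (s ^ 2)" using s by (rule algebraic_mem)
  then have "algebraic s"
    by (rule algebraic_root[where p = "monom 1 2"]) (auto simp: poly_monom degree_monom_eq)
  have "F \<subseteq> E" using mem zero_mem by force
  have "algebraic_field E"
  proof (rule algebraic_fieldI)
    show "algebraic x" if "x \<in> E" for x
      using that algebraic_mem \<open>algebraic s\<close> by (auto simp: mem intro!: algebraic_add algebraic_mult)
    show "\<rat> \<subseteq> E" using rat_mem \<open>F \<subseteq> E\<close> by blast
    fix x y assume "x \<in> E" "y \<in> E"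
    then obtain a b c d where F: "a \<in> F" "b \<in> F" "c \<in> F" "d \<in> F"
      and x: "x = a * s + b" and y: "y = c * s + d" by (auto simp: mem)
    have "x - y = (a - c) * s + (b - d)" by (simp add: x y algebra_simps)
    then show "x - y \<in> E" using F diff_mem unfolding mem by blast
    have "x * y = (a * d + b * c) * s + (a * c * s ^ 2 + b * d)"
      by (simp add: x y algebra_simps power2_eq_square)
    moreover have "a * d + b * c \<in> F" "a * c * s ^ 2 + b * d \<in> F"
      using F s by (auto intro!: add_mem mult_mem)
    ultimately show "x * y \<in> E" unfolding mem by blast
  qed
  moreover have "complex_ring.dimension 2 F E"
    using complex_ring.Suc_dim[OF _ False complex_ring.dimension_one[of F]] F
    by (simp add: E_def algebraic_field_def numeral_2_eq_2)
  ultimately have "extension_of_degree 2 F E"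
    using F \<open>F \<subseteq> E\<close> by (simp add: extension_of_degree_def)
  moreover have "s \<in> E" using mem[of s] one_mem zero_mem by (metis add.right_neutral mult_1)
  ultimately show ?thesis using extension_subset_quadratic_compositum by blast
qed

text \<open>Two independent elements of a plane form a basis. Listing 1 last lets the span unfold to
  \<open>line_extension K u K\<close>.\<close>

lemma extension_of_degree_2_basis:
  assumes "extension_of_degree 2 K L" "u \<in> L" "u \<notin> K" "x \<in> L"
  shows "\<exists>a\<in>K. \<exists>b\<in>K. x = a * u + b"
proof -
  have K: "subfield K complex_ring" and "K \<subseteq> L" and dim: "complex_ring.dimension 2 K L"
    using assms(1) by (auto simp: extension_of_degree_def algebraic_field_def)
  interpret alg_field K
    by unfold_locales (use assms(1) in \<open>simp add: extension_of_degree_def\<close>)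
  have span: "complex_ring.Span K [1] = K"
    by (auto simp: complex_ring.line_extension_mem_iff set_eq_iff)
  have "complex_ring.independent K [u, 1]"
    using assms(3) span complex_ring.independent.li_Nil[of K]
    by (intro complex_ring.independent.li_Cons) auto
  then have "complex_ring.Span K [u, 1] = L"
    using complex_ring.independent_length_eq_dimension[OF K dim, of "[u, 1]"] assms(2) one_mem
      \<open>K \<subseteq> L\<close> by auto
  then have "complex_ring.line_extension K u K = L" using span by simp
  then show ?thesis using assms(4) by (auto simp: complex_ring.line_extension_mem_iff)
qed

text \<open>Otherwise the real part of \<sigma> would be an injective ring homomorphism from
  \<open>L\<close> to the reals.\<close>

lemma totally_imaginary_embedding:
  assumes L: "totally_imaginary L" and \<sigma>: "algebraic_embedding \<sigma>"
  shows "\<exists>x\<in>L. \<sigma> x \<notin> \<real>"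
proof (rule ccontr)
  assume "\<not> (\<exists>x\<in>L. \<sigma> x \<notin> \<real>)"
  then have real: "complex_of_real (Re (\<sigma> x)) = \<sigma> x" "Im (\<sigma> x) = 0" if "x \<in> L" for x
    using that by (auto simp: complex_is_Real_iff complex_eq_iff)
  interpret alg_field L by unfold_locales (use L in \<open>simp add: totally_imaginary_def\<close>)
  interpret algebraic_embedding \<sigma> by fact
  have "(\<lambda>x. Re (\<sigma> x)) \<in> Ring.ring_hom (complex_ring\<lparr>carrier := L\<rparr>) real_ring"
    by (rule ring_hom_memI) (auto simp: hom_add hom_mult hom_1 algebraic_mem real)
  moreover have "inj_on (\<lambda>x. Re (\<sigma> x)) L"
  proof (rule inj_onI)
    fix x y assume xy: "x \<in> L" "y \<in> L" "Re (\<sigma> x) = Re (\<sigma> y)"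
    then have "\<sigma> x = \<sigma> y" using real(1) by metis
    then have "\<sigma> (x - y) = 0" using xy by (simp add: hom_diff algebraic_mem)
    then show "x = y" using xy hom_eq_0_iff[of "x - y"] by (simp add: algebraic_mem algebraic_diff)
  qed
  ultimately show False using L unfolding totally_imaginary_def by blast
qed

section \<open>Units congruent to 1 modulo 3\<close>

text \<open>The unit \<open>u = 1 + 3 * w\<close> and its complex conjugate have the same absolute value under every
  embedding, so \<open>(u / cnj u - 1) / 3\<close> is an algebraic integer all of whose conjugates have absolute
  value at most \<open>2 / 3\<close>.\<close>

lemma unit_congruent_1_mod_3_mem:
  assumes K: "totally_real K" and KL: "extension_of_degree 2 K L" and L: "totally_imaginary L"
    and w: "w \<in> ring_of_integers L" and v: "algebraic_int v" and unit: "w + v + 3 * w * v = 0"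
  shows "w \<in> K"
proof (rule ccontr)
  assume "w \<notin> K"
  have wL: "w \<in> L" and w_int: "algebraic_int w" using w by (auto simp: ring_of_integers_def)
  interpret K: alg_field K using K by unfold_locales (simp add: totally_real_def)
  interpret L: alg_field L using L by unfold_locales (simp add: totally_imaginary_def)
  note basis = extension_of_degree_2_basis[OF KL wL \<open>w \<notin> K\<close>]
  obtain a b where ab: "a \<in> K" "b \<in> K" "w * w = a * w + b"
    using basis[OF L.mult_mem[OF wL wL]] by blast
  have alg: "algebraic w" "algebraic a" "algebraic b"
    using wL ab L.algebraic_mem K.algebraic_mem by auto
  have real: "\<sigma> x \<in> \<real>" if "algebraic_embedding \<sigma>" "x \<in> K" for \<sigma> x
    using K that unfolding totally_real_iff totally_real_numbers_def by blast
  \<comment> \<open>A real value at \<open>w\<close> would make \<sigma> real on all of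
    \<open>L\<close>, since \<open>w\<close> and 1 span \<open>L\<close> over
    \<open>K\<close>.\<close>
  have nonreal: "\<sigma> w \<notin> \<real>" if \<sigma>: "algebraic_embedding \<sigma>" for \<sigma>
  proof
    assume "\<sigma> w \<in> \<real>"
    interpret algebraic_embedding \<sigma> by fact
    have "\<sigma> x \<in> \<real>" if x: "x \<in> L" for x
    proof -
      obtain c d where cd: "c \<in> K" "d \<in> K" "x = c * w + d" using basis[OF x] by blast
      then have "\<sigma> x = \<sigma> c * \<sigma> w + \<sigma> d"
        using alg K.algebraic_mem by (simp add: hom_add hom_mult algebraic_mult)
      then show ?thesis using real[OF \<sigma>] cd \<open>\<sigma> w \<in> \<real>\<close> by simp
    qed
    then show False using totally_imaginary_embedding[OF L \<sigma>] by blast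
  qed
  \<comment> \<open>The images of \<open>a\<close> and \<open>b\<close> are real, so
    \<open>\<sigma> w\<close> and its complex conjugate are the two distinct roots of one real
    quadratic, with sum \<open>\<sigma> a\<close>.\<close>
  have cnj_hom: "cnj (\<sigma> w) = \<sigma> a - \<sigma> w" if \<sigma>: "algebraic_embedding \<sigma>" for \<sigma>
  proof -
    interpret algebraic_embedding \<sigma> by fact
    define z where "z = \<sigma> w"
    have z: "z * z = \<sigma> a * z + \<sigma> b"
      using arg_cong[OF ab(3), of \<sigma>] alg by (simp add: hom_add hom_mult algebraic_mult z_def)
    have cnj_real: "cnj (\<sigma> a) = \<sigma> a" "cnj (\<sigma> b) = \<sigma> b"
      using real[OF \<sigma>] ab by (simp_all add: Reals_cnj_iff)
    have "cnj z * cnj z = \<sigma> a * cnj z + \<sigma> b"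
      using arg_cong[OF z, of cnj] by (simp add: cnj_real)
    with z have "(z - cnj z) * (z + cnj z - \<sigma> a) = 0" by (simp add: algebra_simps)
    moreover have "z \<noteq> cnj z" using nonreal[OF \<sigma>] by (metis Reals_cnj_iff z_def)
    ultimately have "z + cnj z - \<sigma> a = 0" by simp
    then show ?thesis by (simp add: z_def algebra_simps)
  qed
  have cnj_w: "cnj w = a - w" by (rule cnj_hom[OF id_embedding])
  \<comment> \<open>With \<open>u = 1 + 3 * w\<close> this is \<open>(u / cnj u - 1) / 3\<close>:
    the 3 cancels in \<open>u - cnj u\<close>, and \<open>1 + 3 * cnj v\<close> is the inverse of
    \<open>cnj u\<close>. In this form its integrality is visible.\<close>
  define t where "t = (w - cnj w) * (1 + 3 * cnj v)"
  have t_int: "algebraic_int t" unfolding t_def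
    by (intro algebraic_int_mult algebraic_int_diff algebraic_int_add algebraic_int_cnj w_int v)
      (auto intro: int_imp_algebraic_int)
  have "(1 + 3 * w) * (1 + 3 * v) = 1 + 3 * (w + v + 3 * w * v)" by (simp add: algebra_simps)
  also have "\<dots> = 1" using unit by simp
  finally have "cnj ((1 + 3 * w) * (1 + 3 * v)) = cnj 1" by (rule arg_cong)
  then have cnj_unit: "(1 + 3 * cnj w) * (1 + 3 * cnj v) = 1" by simp
  have "norm (\<sigma> t) < 1" if \<sigma>: "algebraic_embedding \<sigma>" for \<sigma>
  proof -
    interpret algebraic_embedding \<sigma> by fact
    define z where "z = \<sigma> w"
    have v_alg: "algebraic (cnj v)" using v by (intro algebraic_cnj) blast
    \<comment> \<open>Conjugation takes \<open>w\<close> to \<open>a - w\<close> here and under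
      every embedding, so it commutes with \<sigma> at \<open>w\<close>.\<close>
    have w_cnj: "\<sigma> (cnj w) = cnj z"
      unfolding cnj_w z_def cnj_hom[OF \<sigma>] by (simp add: hom_diff alg)
    have alg': "algebraic (1 + 3 * cnj w)" "algebraic (1 + 3 * cnj v)"
      using alg v_alg by (auto intro!: algebraic_add algebraic_mult)
    have u: "\<sigma> (1 + 3 * cnj w) = 1 + 3 * cnj z"
      using alg by (simp add: hom_add hom_mult hom_1 hom_numeral w_cnj algebraic_mult algebraic_cnj)
    define q where "q = \<sigma> (1 + 3 * cnj v)"
    have "(1 + 3 * cnj z) * q = 1"
      using arg_cong[OF cnj_unit, of \<sigma>] alg' by (simp add: hom_mult hom_1 u q_def)
    then have "norm (1 + 3 * cnj z) * norm q = 1" by (metis norm_mult norm_one)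
    moreover have eq: "norm (1 + 3 * cnj z) = norm (1 + 3 * z)"
      by (metis complex_cnj_add complex_cnj_mult complex_cnj_numeral complex_cnj_one complex_mod_cnj)
    ultimately have q: "norm (1 + 3 * z) * norm q = 1" by simp
    \<comment> \<open>Two numbers of equal norm differ by at most twice that norm. Multiplication by
      \<open>norm q\<close> then bounds \<open>norm (\<sigma> t)\<close> by 2/3; this is where the
      modulus 3 beats the factor 2.\<close>
    have "norm (3 * (z - cnj z)) = norm ((1 + 3 * z) - (1 + 3 * cnj z))" by (simp add: algebra_simps)
    also have "\<dots> \<le> 2 * norm (1 + 3 * z)"
      using norm_triangle_ineq4[of "1 + 3 * z" "1 + 3 * cnj z"] eq by simp
    finally have "3 * norm (z - cnj z) \<le> 2 * norm (1 + 3 * z)"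
      by (simp only: norm_mult norm_numeral)
    then have "3 * norm (z - cnj z) * norm q \<le> 2 * norm (1 + 3 * z) * norm q"
      by (rule mult_right_mono) simp
    moreover have "\<sigma> t = (z - cnj z) * q"
      using alg alg' by (simp add: t_def hom_mult hom_diff w_cnj z_def q_def algebraic_diff algebraic_cnj)
    ultimately show ?thesis using q by (simp add: norm_mult)
  qed
  then have "t = 0" by (rule algebraic_int_conjugates_small[OF t_int])
  moreover have "1 + 3 * cnj v \<noteq> 0" using cnj_unit by auto
  ultimately have "cnj w = w" by (simp add: t_def)
  then show False using nonreal[OF id_embedding] by (simp add: Reals_cnj_iff)
qed

section \<open>Units from totally positive square roots\<close>

lemma real_of_square_nonneg:
  assumes "z ^ 2 = complex_of_real r" "r \<ge> 0"
  shows "z \<in> \<real>"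
proof -
  have "z ^ 2 = (complex_of_real (sqrt r)) ^ 2" using assms by (simp flip: of_real_power)
  then show ?thesis by (auto simp: power2_eq_iff)
qed

text \<open>Every embedding sends \<open>x\<close> to a real number, hence
  \<open>9 * x ^ 2 + 2\<close> to a positive one, whose square roots are real.\<close>

lemma totally_real_sqrt:
  assumes x: "x \<in> totally_real_numbers" and s: "s ^ 2 = 9 * x ^ 2 + 2"
  shows "s \<in> totally_real_numbers"
proof -
  have x_alg: "algebraic x" using x by (simp add: totally_real_numbers_def)
  have "algebraic (s ^ 2)" unfolding s unfolding power2_eq_square
    by (intro algebraic_add algebraic_mult x_alg) auto
  then have s_alg: "algebraic s"
    by (rule algebraic_root[where p = "monom 1 2"]) (auto simp: poly_monom degree_monom_eq)
  have "\<sigma> s \<in> \<real>" if "algebraic_embedding \<sigma>" for \<sigma>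
  proof -
    interpret algebraic_embedding \<sigma> by fact
    have "\<sigma> x \<in> \<real>" using x that by (simp add: totally_real_numbers_def)
    then obtain r where r: "\<sigma> x = complex_of_real r" by (rule Reals_cases)
    have "(\<sigma> s) ^ 2 = \<sigma> (s ^ 2)" using s_alg by (simp add: power2_eq_square hom_mult)
    also have "\<dots> = 9 * (\<sigma> x) ^ 2 + 2" unfolding s using x_alg
      by (simp add: power2_eq_square hom_mult hom_add hom_numeral algebraic_mult)
    also have "\<dots> = complex_of_real (9 * r ^ 2 + 2)" by (simp add: r)
    finally show ?thesis by (rule real_of_square_nonneg) simp
  qed
  then show ?thesis using s_alg by (simp add: totally_real_numbers_def)
qed

lemma base_subset_maximal_totally_real_subfield:
  assumes F: "totally_real F" and M: "maximal_totally_real_subfield M (quadratic_compositum F)"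
  shows "F \<subseteq> M"
  using F base_subset_quadratic_compositum
    maximal_totally_real_subfield_eq[OF M subfield_quadratic_compositum]
  unfolding totally_real_iff by blast

text \<open>The unit \<open>1 + 9 * x\<^sup>2 + 3 * x * sqrt (9 * x\<^sup>2 + 2)\<close> is written as \<open>1 + 3 * w\<close>, and its
  inverse as \<open>1 + 3 * v\<close>.\<close>

lemma square_from_units:
  assumes K\<^sub>0: "totally_real K\<^sub>0" and K\<^sub>1: "maximal_totally_real_subfield K\<^sub>1 (quadratic_compositum K\<^sub>0)"
    and x: "x \<in> ring_of_integers K\<^sub>0"
  shows "\<exists>w\<in>ring_of_integers K\<^sub>1. \<exists>v\<in>ring_of_integers K\<^sub>1. w + v + 3 * w * v = 0 \<and> w + v = 6 * x ^ 2"
proof -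
  have field: "algebraic_field K\<^sub>0" using K\<^sub>0 by (simp add: totally_real_def)
  interpret K\<^sub>0: alg_field K\<^sub>0 by unfold_locales (rule field)
  interpret K\<^sub>1: alg_field K\<^sub>1 by unfold_locales
      (use K\<^sub>1 in \<open>simp add: maximal_totally_real_subfield_def totally_real_def\<close>)
  have K\<^sub>1_eq: "K\<^sub>1 = quadratic_compositum K\<^sub>0 \<inter> totally_real_numbers"
    by (rule maximal_totally_real_subfield_eq[OF K\<^sub>1 subfield_quadratic_compositum])
  have xK: "x \<in> K\<^sub>0" and x_int: "algebraic_int x" using x by (auto simp: ring_of_integers_def)
  have x_real: "x \<in> totally_real_numbers" using K\<^sub>0 xK by (auto simp: totally_real_iff)
  \<comment> \<open>The radicand makes \<open>(1 + 9 * x ^ 2) ^ 2 - 9 * x ^ 2 * s ^ 2 = 1\<close>,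
    so changing the sign of \<open>s\<close> inverts
    \<open>1 + 9 * x ^ 2 + 3 * x * s\<close>.\<close>
  define s where "s = csqrt (9 * x ^ 2 + 2)"
  have s: "s ^ 2 = 9 * x ^ 2 + 2" by (simp add: s_def)
  have "9 * x ^ 2 + 2 \<in> K\<^sub>0" unfolding power2_eq_square
    by (intro K\<^sub>0.add_mem K\<^sub>0.mult_mem K\<^sub>0.numeral_mem xK)
  then have "s \<in> K\<^sub>1"
    unfolding K\<^sub>1_eq using sqrt_mem_quadratic_compositum[OF field] totally_real_sqrt[OF x_real s] s by simp
  moreover have "x \<in> K\<^sub>1"
    using base_subset_maximal_totally_real_subfield[OF K\<^sub>0 K\<^sub>1] xK by blast
  ultimately have mem: "3 * x ^ 2 + x * s \<in> K\<^sub>1" "3 * x ^ 2 - x * s \<in> K\<^sub>1" unfolding power2_eq_square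
    by (auto intro!: K\<^sub>1.add_mem K\<^sub>1.diff_mem K\<^sub>1.mult_mem K\<^sub>1.numeral_mem)
  have num: "algebraic_int (numeral n :: complex)" for n by (auto intro: int_imp_algebraic_int)
  have "algebraic_int s" unfolding s_def power2_eq_square
    by (intro algebraic_int_csqrt algebraic_int_add algebraic_int_mult x_int num)
  then have int: "algebraic_int (3 * x ^ 2 + x * s)" "algebraic_int (3 * x ^ 2 - x * s)"
    unfolding power2_eq_square
    by (auto intro!: algebraic_int_add algebraic_int_diff algebraic_int_mult x_int num)
  have "(3 * x ^ 2 + x * s) * (3 * x ^ 2 - x * s) = 9 * x ^ 4 - x ^ 2 * s ^ 2"
    by (simp add: algebra_simps power2_eq_square power4_eq_xxxx)
  also have "\<dots> = - 2 * x ^ 2" unfolding s by (simp add: algebra_simps power2_eq_square power4_eq_xxxx)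
  finally have prod: "(3 * x ^ 2 + x * s) * (3 * x ^ 2 - x * s) = - 2 * x ^ 2" .
  show ?thesis
  proof (intro bexI conjI)
    have "3 * (3 * x ^ 2 + x * s) * (3 * x ^ 2 - x * s) = - 6 * x ^ 2"
      by (simp only: mult.assoc prod) simp
    \<comment> \<open>This fixes the witnesses left open by \<open>bexI\<close>: \<open>w\<close>
      and \<open>v\<close> differ in the sign of \<open>s\<close>.\<close>
    then show "(3 * x ^ 2 + x * s) + (3 * x ^ 2 - x * s) + 3 * (3 * x ^ 2 + x * s) * (3 * x ^ 2 - x * s) = 0"
      by simp
  qed (use mem int in \<open>simp_all add: ring_of_integers_def\<close>)
qed

section \<open>The defining formula and the theorem\<close>

text \<open>The only constants of the language are 0 and 1, and parameters are excluded, so numerals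
  are spelled out as sums.\<close>

primrec nat_term :: "nat \<Rightarrow> ring_term" where
  "nat_term 0 = TZero"
| "nat_term (Suc n) = TAdd TOne (nat_term n)"

lemma term_value_nat_term [simp]:
  "term_value (complex_ring\<lparr>carrier := A\<rparr>) e (nat_term n) = of_nat n"
  by (induction n) simp_all

text \<open>For values \<open>w\<close> and \<open>v\<close> this says
  \<open>(1 + 3 * w) * (1 + 3 * v) = 1\<close>, with the 1 cancelled and a factor 3 removed: a unit
  congruent to 1 modulo 3, together with its inverse.\<close>

definition unit_formula :: "nat \<Rightarrow> nat \<Rightarrow> qf_formula" where
  "unit_formula i j = QEq (TAdd (TAdd (TVar i) (TVar j)) (TMult (TMult (nat_term 3) (TVar i)) (TVar j))) TZero"

text \<open>The linear equation comes from \<open>6 * (y + 1)\<^sup>2 = 6 * y\<^sup>2 + (12 * y + 6)\<close>.\<close>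

definition defining_formula :: qf_formula where
  "defining_formula = QAnd (QAnd (unit_formula 1 2) (unit_formula 3 4))
     (QEq (TAdd (TVar 1) (TVar 2))
       (TAdd (TAdd (TVar 3) (TVar 4)) (TAdd (TMult (nat_term 12) (TVar 0)) (nat_term 6))))"

lemma defining_formula_holds_iff:
  "qf_holds (complex_ring\<lparr>carrier := A\<rparr>) e defining_formula \<longleftrightarrow>
     e 1 + e 2 + 3 * e 1 * e 2 = 0 \<and> e 3 + e 4 + 3 * e 3 * e 4 = 0 \<and>
     e 1 + e 2 = e 3 + e 4 + (12 * e 0 + 6)"
  by (simp add: defining_formula_def unit_formula_def)

theorem theorem3p3:
  fixes K\<^sub>0 K\<^sub>1 K L :: "complex set"
  assumes "totally_real K\<^sub>0"
    and "maximal_totally_real_subfield K\<^sub>1 (quadratic_compositum K\<^sub>0)"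
    and "totally_real K"
    and "K\<^sub>1 \<subseteq> K"
    and "extension_of_degree 2 K L"
    and "totally_imaginary L"
  shows "\<exists>S \<subseteq> ring_of_integers L.
    existentially_definable (complex_ring\<lparr>carrier := ring_of_integers L\<rparr>) S \<and>
    ring_of_integers K\<^sub>0 \<subseteq> S \<and> S \<subseteq> ring_of_integers K"
proof -
  define O_L where "O_L = ring_of_integers L"
  define S where "S = {y \<in> O_L. \<exists>e. (\<forall>i. e i \<in> O_L) \<and> e 0 = y \<and>
    qf_holds (complex_ring\<lparr>carrier := O_L\<rparr>) e defining_formula}"
  have K: "algebraic_field K" using assms(3) by (simp add: totally_real_def)
  interpret K: alg_field K by unfold_locales (rule K)
  have K\<^sub>1L: "K\<^sub>1 \<subseteq> L" using assms(4,5) by (auto simp: extension_of_degree_def)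
  \<comment> \<open>The equation is symmetric, so \<open>unit_congruent_1_mod_3_mem\<close> applies
    to \<open>w\<close> and to \<open>v\<close>.\<close>
  have unit_mem: "w \<in> K" "v \<in> K" if "w \<in> O_L" "v \<in> O_L" "w + v + 3 * w * v = 0" for w v
    using that unit_congruent_1_mod_3_mem[OF assms(3,5,6), of w v]
      unit_congruent_1_mod_3_mem[OF assms(3,5,6), of v w]
    by (auto simp: O_L_def ring_of_integers_def ac_simps)
  have "ring_of_integers K\<^sub>0 \<subseteq> S"
  proof
    fix x assume x: "x \<in> ring_of_integers K\<^sub>0"
    interpret K\<^sub>0: alg_field K\<^sub>0 by unfold_locales (use assms(1) in \<open>simp add: totally_real_def\<close>)
    have "x + 1 \<in> ring_of_integers K\<^sub>0" using x
      by (auto simp: ring_of_integers_def intro!: K\<^sub>0.add_mem K\<^sub>0.one_mem algebraic_int_add algebraic_int_1)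
    from square_from_units[OF assms(1,2) this] square_from_units[OF assms(1,2) x]
    obtain w v w' v' where units:
      "w \<in> ring_of_integers K\<^sub>1" "v \<in> ring_of_integers K\<^sub>1" "w + v + 3 * w * v = 0" "w + v = 6 * (x + 1) ^ 2"
      "w' \<in> ring_of_integers K\<^sub>1" "v' \<in> ring_of_integers K\<^sub>1" "w' + v' + 3 * w' * v' = 0" "w' + v' = 6 * x ^ 2"
      by blast
    have mem: "x \<in> O_L" "w \<in> O_L" "v \<in> O_L" "w' \<in> O_L" "v' \<in> O_L"
      using x units K\<^sub>1L base_subset_maximal_totally_real_subfield[OF assms(1,2)]
      by (auto simp: O_L_def ring_of_integers_def)
    \<comment> \<open>Assignments are total: all indices from 4 on receive \<open>v'\<close>, which
      keeps every value in \<open>O_L\<close>.\<close>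
    define e where "e = (\<lambda>i :: nat. if i = 0 then x else if i = 1 then w else if i = 2 then v
      else if i = 3 then w' else v')"
    have "6 * (x + 1) ^ 2 = 6 * x ^ 2 + (12 * x + 6)" by (simp add: algebra_simps power2_eq_square)
    then have "qf_holds (complex_ring\<lparr>carrier := O_L\<rparr>) e defining_formula"
      using units unfolding defining_formula_holds_iff by (simp add: e_def)
    moreover have "\<forall>i. e i \<in> O_L" "e 0 = x" using mem by (auto simp: e_def)
    ultimately show "x \<in> S" using mem(1) unfolding S_def by blast
  qed
  moreover have "S \<subseteq> ring_of_integers K"
  proof
    fix y assume "y \<in> S"
    then have y: "y \<in> O_L" by (simp add: S_def)
    from \<open>y \<in> S\<close> obtain e where e: "\<forall>i. e i \<in> O_L" "e 0 = y"
      and holds: "qf_holds (complex_ring\<lparr>carrier := O_L\<rparr>) e defining_formula"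
      unfolding S_def by blast
    note eqs = holds[unfolded defining_formula_holds_iff]
    have units: "e 1 \<in> K" "e 2 \<in> K" "e 3 \<in> K" "e 4 \<in> K"
      using unit_mem[of "e 1" "e 2"] unit_mem[of "e 3" "e 4"] e(1) eqs by blast+
    have "e 1 + e 2 = e 3 + e 4 + (12 * y + 6)" using eqs e(2) by simp
    \<comment> \<open>The field \<open>K\<close> permits the division by 12; integrality of
      \<open>y\<close> is known from \<open>O_L\<close>.\<close>
    then have "y = (e 1 + e 2 - (e 3 + e 4) - 6) * inverse 12" by simp
    also have "\<dots> \<in> K"
      by (intro K.mult_mem K.diff_mem K.add_mem K.inverse_mem K.numeral_mem units)
    finally show "y \<in> ring_of_integers K" using y by (simp add: O_L_def ring_of_integers_def)
  qed
  moreover have "existentially_definable (complex_ring\<lparr>carrier := O_L\<rparr>) S"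
    unfolding existentially_definable_def S_def by (intro exI[of _ defining_formula]) simp
  moreover have "S \<subseteq> O_L" by (auto simp: S_def)
  ultimately show ?thesis unfolding O_L_def by blast
qed

end
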